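(* Let $(M,d)$ be a metric space and $K$ a nonempty compact subset of $M$. Let $1\le p<\infty$, let $f:M\to\mathbb R$ be a mapping and let $C>0$. Then the following statements are equivalent. (i) For every $n\in\mathbb N$ and all $x_1,\dots,x_n,y_1,\dots,y_n\in M$, $$\Big(\sum_{i=1}^n |f(x_i)-f(y_i)|^p\Big)^{1/p}\le C\,\sup_{w\in K}\Big(\sum_{i=1}^n |d(x_i,w)-d(y_i,w)|^p\Big)^{1/p}.$$ (ii) There exists a regular Borel probability measure $\mu$ on $K$ such that for all $x,y\in M$, $$|f(x)-f(y)|\le C\Big(\int_K |d(x,w)-d(y,w)|^p\,d\mu(w)\Big)^{1/p}.$$ Moreover, a real function $f$ satisfying (i) or (ii) is Lipschitz with constant at most $C$.
   Context: A function $f:M\to\mathbb R$ is Lipschitz with constant at most $C$ if $|f(x)-f(y)|\le C\,d(x,y)$ for all $x,y\in M$. A function satisfying (i) or (ii) is called an eccentric $p$-summing functional (this is only terminology). *)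

theory Defs
  imports "HOL-Probability.Probability"
begin

text \<open>
  Regular Borel probability measures on \<open>K\<close>, where \<open>K\<close> carries the subspace topology: the
  measure space has carrier \<open>K\<close>, and openness in outer regularity is relative to \<open>K\<close>.
  Compactness does not depend on the ambient space. Compact subsets of members of the
  sigma-algebra are closed in the metric space and hence measurable.
\<close>

definition regular_borel_prob_on :: "'a::metric_space set \<Rightarrow> 'a measure \<Rightarrow> bool" where
  "regular_borel_prob_on K \<mu> \<longleftrightarrow>
     prob_space \<mu> \<and>
     space \<mu> = K \<and>
     sets \<mu> = sets (restrict_space borel K) \<and>
     (\<forall>A\<in>sets \<mu>.
        emeasure \<mu> A = (SUP Q\<in>{Q. compact Q \<and> Q \<subseteq> A}. emeasure \<mu> Q) \<and>
        emeasure \<mu> A = (INF U\<in>{U. openin (top_of_set K) U \<and> A \<subseteq> U}. emeasure \<mu> U))"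

text \<open>
  The two inequalities below are used for compact nonempty \<open>K\<close> and \<open>p \<ge> 1\<close> only. The functions
  of \<open>w\<close> involved are then continuous on \<open>K\<close>, so the real supremum is that of a bounded
  nonempty set, and the Bochner integral is that of an integrable function. Since
  \<open>0 powr a = 0\<close>, the operator \<open>powr\<close> agrees with the usual power on nonnegative
  bases for the positive exponents \<open>p\<close> and \<open>1/p\<close>. The case \<open>n = 0\<close> reads \<open>0 \<le> 0\<close>.
\<close>

definition eccentric_finite_sums ::
    "real \<Rightarrow> real \<Rightarrow> 'a::metric_space set \<Rightarrow> ('a \<Rightarrow> real) \<Rightarrow> bool" where
  "eccentric_finite_sums p C K f \<longleftrightarrow>
     (\<forall>(n::nat) (x::nat \<Rightarrow> 'a) (y::nat \<Rightarrow> 'a).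
        (\<Sum>i=1..n. \<bar>f (x i) - f (y i)\<bar> powr p) powr (1 / p)
          \<le> C * (SUP w\<in>K. (\<Sum>i=1..n. \<bar>dist (x i) w - dist (y i) w\<bar> powr p) powr (1 / p)))"

definition eccentric_dominated ::
    "real \<Rightarrow> real \<Rightarrow> 'a::metric_space set \<Rightarrow> ('a \<Rightarrow> real) \<Rightarrow> bool" where
  "eccentric_dominated p C K f \<longleftrightarrow>
     (\<exists>\<mu>. regular_borel_prob_on K \<mu> \<and>
        (\<forall>x y. \<bar>f x - f y\<bar>
          \<le> C * (\<integral>w. \<bar>dist x w - dist y w\<bar> powr p \<partial>\<mu>) powr (1 / p)))"

end

theory Submission
  imports Defs
begin

text \<open>
  This is Pietsch's domination argument. Put
  \<open>g (x, y) w = C\<^sup>p * |d(x,w) - d(y,w)|\<^sup>p - |f x - f y|\<^sup>p\<close>. Condition (i) says that every finite sum of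
  functions \<open>g (x, y)\<close>, with repetitions, is nonnegative somewhere on \<open>K\<close>; condition (ii) asks for a
  probability measure under which all of them have nonnegative integral. For finitely many of the
  functions, a greedy choice of points of \<open>K\<close> gives empirical measures whose integrals are at least
  \<open>- \<epsilon>\<close>. Since countably many functions are uniformly dense among the \<open>g (x, y)\<close>, it remains
  to pass to a weak limit. Neither the Riesz representation theorem nor Prokhorov's theorem on metric
  spaces is needed: \<open>K\<close> is a continuous image of a compact set of reals, so the measures can be
  lifted to the line, where Helly's selection theorem applies, and the limit is pushed back to \<open>K\<close>.
\<close>

section \<open>Finite families: empirical measures from a greedy choice of points\<close>

text \<open>
  The choice of \<open>v T\<close> is Blackwell's approachability strategy for the nonnegative orthant: weighting
  the functions by their current deficits (rounded down, as only integer weights are available) keeps the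
  cross terms in the squared distance to the orthant bounded.
\<close>

lemma finite_approachability:
  fixes g :: "'i \<Rightarrow> 'a \<Rightarrow> real"
  assumes I: "finite I"
    and bdd: "\<And>i w. i \<in> I \<Longrightarrow> w \<in> K \<Longrightarrow> \<bar>g i w\<bar> \<le> B"
    and hyp: "\<And>m :: 'i \<Rightarrow> nat. \<exists>w\<in>K. 0 \<le> (\<Sum>i\<in>I. real (m i) * g i w)"
  shows "\<exists>v. (\<forall>t. v t \<in> K) \<and>
    (\<Sum>i\<in>I. (max 0 (- (\<Sum>t<T. g i (v t))))\<^sup>2) \<le> real T * (real (card I) * (2 * B + B\<^sup>2))"
proof (induction T)
  case 0
  obtain w where "w \<in> K" using hyp by blast
  then show ?case by (intro exI[of _ "\<lambda>_. w"]) auto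
next
  case (Suc T)
  then obtain v where vK: "\<And>t. v t \<in> K" and
    v: "(\<Sum>i\<in>I. (max 0 (- (\<Sum>t<T. g i (v t))))\<^sup>2) \<le> real T * (real (card I) * (2 * B + B\<^sup>2))"
    by blast
  define u where "u i = max 0 (- (\<Sum>t<T. g i (v t)))" for i
  define m where "m i = nat \<lfloor>u i\<rfloor>" for i
  obtain w where w: "w \<in> K" "0 \<le> (\<Sum>i\<in>I. real (m i) * g i w)"
    using hyp[of m] by blast
  have step: "(max 0 (- (\<Sum>t<Suc T. g i ((v(T := w)) t))))\<^sup>2
      \<le> (u i)\<^sup>2 - 2 * (real (m i) * g i w) + (2 * B + B\<^sup>2)" if "i \<in> I" for i
  proof -
    have a: "\<bar>g i w\<bar> \<le> B" using bdd[OF that w(1)] .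
    have u: "\<bar>u i - real (m i)\<bar> \<le> 1" unfolding m_def u_def by linarith
    have "\<bar>(u i - real (m i)) * g i w\<bar> \<le> 1 * B"
      unfolding abs_mult using a u by (intro mult_mono) auto
    then have 1: "- (u i * g i w) \<le> - (real (m i) * g i w) + B"
      by (simp add: algebra_simps abs_le_iff)
    have "(\<Sum>t<Suc T. g i ((v(T := w)) t)) = (\<Sum>t<T. g i (v t)) + g i w" by simp
    \<comment> \<open>\<open>u i\<close> is at least minus the old sum, so the new deficit is either
      \<open>0\<close> or at most \<open>u i - g i w\<close>.\<close>
    then have "\<bar>max 0 (- (\<Sum>t<Suc T. g i ((v(T := w)) t)))\<bar> \<le> \<bar>u i - g i w\<bar>"
      unfolding u_def by linarith
    then have "(max 0 (- (\<Sum>t<Suc T. g i ((v(T := w)) t))))\<^sup>2 \<le> (u i - g i w)\<^sup>2"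
      using abs_le_square_iff by blast
    also have "\<dots> = (u i)\<^sup>2 - 2 * (u i * g i w) + (g i w)\<^sup>2"
      by (simp add: power2_eq_square algebra_simps)
    also have "(g i w)\<^sup>2 \<le> B\<^sup>2" using a abs_le_square_iff[of "g i w" B] by auto
    finally show ?thesis using 1 by linarith
  qed
  have "(\<Sum>i\<in>I. (max 0 (- (\<Sum>t<Suc T. g i ((v(T := w)) t))))\<^sup>2)
      \<le> (\<Sum>i\<in>I. (u i)\<^sup>2 - 2 * (real (m i) * g i w) + (2 * B + B\<^sup>2))"
    by (intro sum_mono step)
  also have "\<dots> = (\<Sum>i\<in>I. (u i)\<^sup>2) - 2 * (\<Sum>i\<in>I. real (m i) * g i w)
      + real (card I) * (2 * B + B\<^sup>2)"
    by (simp add: sum.distrib sum_subtractf sum_distrib_left)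
  \<comment> \<open>The subtracted sum is nonnegative by the choice of \<open>w\<close>; hence the
    total squared deficit grows by at most a constant at each time.\<close>
  also have "\<dots> \<le> real (Suc T) * (real (card I) * (2 * B + B\<^sup>2))"
    using v w(2) unfolding u_def by (simp add: algebra_simps)
  finally show ?case
    using vK w(1) by (intro exI[of _ "v(T := w)"]) auto
qed

text \<open>The total squared deficit grows only linearly in the number \<open>T\<close> of points,
  so each deficit is of order \<open>sqrt T\<close> and becomes small after averaging. The uniform
  distribution on the points, counted with multiplicity, serves as \<open>P\<close>. Integer weights
  become lists by repeating each function.\<close>

lemma finite_family_expectation:
  fixes G :: "('a \<Rightarrow> real) set"
  assumes G: "finite G"
    and bdd: "\<And>g w. g \<in> G \<Longrightarrow> w \<in> K \<Longrightarrow> \<bar>g w\<bar> \<le> B"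
    and hyp: "\<And>gs. set gs \<subseteq> G \<Longrightarrow> \<exists>w\<in>K. 0 \<le> (\<Sum>g\<leftarrow>gs. g w)"
    and e: "e > 0"
  shows "\<exists>P. set_pmf P \<subseteq> K \<and> (\<forall>g\<in>G. - e \<le> measure_pmf.expectation P g)"
proof -
  have hyp': "\<exists>w\<in>K. 0 \<le> (\<Sum>g\<in>G. real (m g) * g w)" for m :: "('a \<Rightarrow> real) \<Rightarrow> nat"
  proof -
    obtain gl where gl: "set gl = G" "distinct gl" using finite_distinct_list[OF G] by blast
    have "(\<Sum>h\<leftarrow>concat (map (\<lambda>g. replicate (m g) g) gl). h w) = (\<Sum>g\<in>G. real (m g) * g w)" for w
    proof -
      have "(\<Sum>h\<leftarrow>concat (map (\<lambda>g. replicate (m g) g) gl). h w) = (\<Sum>g\<leftarrow>gl. real (m g) * g w)"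
        by (induction gl) (auto simp: sum_list_replicate)
      also have "\<dots> = (\<Sum>g\<in>G. real (m g) * g w)"
        using gl by (simp add: sum_list_distinct_conv_sum_set)
      finally show ?thesis .
    qed
    moreover have "\<exists>w\<in>K. 0 \<le> (\<Sum>h\<leftarrow>concat (map (\<lambda>g. replicate (m g) g) gl). h w)"
      by (rule hyp) (use gl in auto)
    ultimately show ?thesis by (simp only:)
  qed
  define c where "c = real (card G) * (2 * \<bar>B\<bar> + B\<^sup>2)"
  \<comment> \<open>This threshold gives \<open>T * c \<le> (T * e)\<^sup>2\<close>, so that every
    deficit is at most \<open>T * e\<close>.\<close>
  obtain T0 :: nat where T0: "c / e\<^sup>2 < real T0" using reals_Archimedean2 by blast
  define T where "T = Suc T0"
  have T: "c / e\<^sup>2 < real T" "T > 0" using T0 by (auto simp: T_def)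
  have "\<bar>g w\<bar> \<le> \<bar>B\<bar>" if "g \<in> G" "w \<in> K" for g w
    using bdd[OF that] by linarith
  then have "\<exists>v. (\<forall>t. v t \<in> K) \<and>
      (\<Sum>g\<in>G. (max 0 (- (\<Sum>t<T. g (v t))))\<^sup>2) \<le> real T * (real (card G) * (2 * \<bar>B\<bar> + \<bar>B\<bar>\<^sup>2))"
    by (intro finite_approachability[where g = "\<lambda>g. g"] G hyp')
  then obtain v where vK: "\<And>t. v t \<in> K" and
    v: "(\<Sum>g\<in>G. (max 0 (- (\<Sum>t<T. g (v t))))\<^sup>2) \<le> real T * c"
    unfolding c_def power2_abs by blast
  define P where "P = map_pmf v (pmf_of_set {..<T})"
  have ne: "{..<T} \<noteq> {}" using T by auto
  have "- e \<le> measure_pmf.expectation P g" if g: "g \<in> G" for g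
  proof -
    have "(max 0 (- (\<Sum>t<T. g (v t))))\<^sup>2 \<le> (\<Sum>g\<in>G. (max 0 (- (\<Sum>t<T. g (v t))))\<^sup>2)"
      using G g by (intro member_le_sum) auto
    also have "\<dots> \<le> real T * c" by (rule v)
    also have "\<dots> \<le> real T * (real T * e\<^sup>2)"
      using T e by (intro mult_left_mono) (auto simp: field_simps)
    also have "\<dots> = (real T * e)\<^sup>2" by (simp add: power2_eq_square)
    finally have "max 0 (- (\<Sum>t<T. g (v t))) \<le> real T * e"
      using e by (meson power2_le_imp_le less_imp_le mult_nonneg_nonneg of_nat_0_le_iff)
    then have "- e \<le> (\<Sum>t<T. g (v t)) / real T" using T by (simp add: field_simps)
    then show ?thesis
      unfolding P_def integral_map_pmf using ne by (simp add: integral_pmf_of_set)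
  qed
  moreover have "set_pmf P \<subseteq> K" unfolding P_def using vK ne by (auto)
  ultimately show ?thesis by blast
qed

section \<open>Finite nets and countable uniformly dense families\<close>

lemma compact_finite_nets:
  fixes K :: "'a::metric_space set"
  assumes K: "compact K"
  obtains F :: "nat \<Rightarrow> 'a set" where "\<And>n. finite (F n)" "\<And>n. F n \<subseteq> K"
    "\<And>n. K \<subseteq> (\<Union>x\<in>F n. ball x (1 / real (Suc n)))"
proof -
  have "\<forall>n. \<exists>F. finite F \<and> F \<subseteq> K \<and> K \<subseteq> (\<Union>x\<in>F. ball x (1 / real (Suc n)))"
    using seq_compact_imp_totally_bounded[of K] K compact_imp_seq_compact by force
  then show ?thesis using that by metis
qed

text \<open>This is separability of the continuous functions on a compact set, with approximants
  taken inside \<open>G\<close> so that they inherit what is assumed of \<open>G\<close>. Functions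
  with a common modulus of continuity are determined, up to a small uniform error, by their rounded
  values on a finite net.\<close>

lemma countable_uniformly_dense_subset:
  fixes K :: "'a::metric_space set" and G :: "('a \<Rightarrow> real) set"
  assumes K: "compact K" and cont: "\<And>g. g \<in> G \<Longrightarrow> continuous_on K g"
  shows "\<exists>D\<subseteq>G. countable D \<and> (\<forall>g\<in>G. \<forall>e>0. \<exists>h\<in>D. \<forall>w\<in>K. \<bar>g w - h w\<bar> < e)"
proof -
  obtain F where F: "\<And>n. finite (F n)" "\<And>n. F n \<subseteq> K"
    "\<And>n. K \<subseteq> (\<Union>x\<in>F n. ball x (1 / real (Suc n)))"
    using compact_finite_nets[OF K] by blast
  \<comment> \<open>By uniform continuity, for every \<open>m\<close> each member of
    \<open>G\<close> lies in some \<open>H m n\<close>.\<close>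
  define H where "H m n = {g \<in> G. \<forall>w\<in>K. \<forall>w'\<in>K. dist w w' < 1 / real (Suc n) \<longrightarrow> \<bar>g w - g w'\<bar> < 1 / real (Suc m)}" for m n
  define r where "r m n g = restrict (\<lambda>w. \<lfloor>real (Suc m) * g w\<rfloor>) (F n)" for m n and g :: "'a \<Rightarrow> real"
  \<comment> \<open>One representative is kept for each rounded profile; there are countably many
    profiles, as they are integer-valued functions on a finite set.\<close>
  have "\<exists>D. countable D \<and> D \<subseteq> H m n \<and> r m n ` H m n = r m n ` D" for m n
  proof -
    have "r m n ` H m n \<subseteq> Pi\<^sub>E (F n) (\<lambda>_. UNIV)" unfolding r_def by auto
    moreover have "countable (Pi\<^sub>E (F n) (\<lambda>_. UNIV :: int set))"
      by (intro countable_PiE F) auto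
    ultimately have "countable (r m n ` H m n)" by (rule countable_subset)
    then show ?thesis using countable_subset_image[of "r m n ` H m n" "r m n" "H m n"] by auto
  qed
  then obtain D where D: "\<And>m n. countable (D m n)" "\<And>m n. D m n \<subseteq> H m n"
    "\<And>m n. r m n ` H m n = r m n ` D m n" by metis
  have "\<exists>h\<in>(\<Union>m n. D m n). \<forall>w\<in>K. \<bar>g w - h w\<bar> < e" if g: "g \<in> G" and e: "e > 0" for g e
  proof -
    \<comment> \<open>Three errors below \<open>1 / Suc m\<close> arise later: moving
      \<open>g\<close> to a net point, moving \<open>h\<close> there, and comparing the two at that
      point.\<close>
    obtain m where m: "1 / real (Suc m) < e / 3"
      using e nat_approx_posE[of "e / 3"] by auto
    have "uniformly_continuous_on K g"
      using compact_uniformly_continuous cont g K by blast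
    then obtain d where d: "d > 0"
      "\<forall>w\<in>K. \<forall>w'\<in>K. dist w' w < d \<longrightarrow> dist (g w') (g w) < 1 / real (Suc m)"
      unfolding uniformly_continuous_on_def by (metis of_nat_0_less_iff zero_less_Suc zero_less_divide_1_iff)
    obtain n where n: "1 / real (Suc n) < d" using d(1) nat_approx_posE by blast
    have "g \<in> H m n" unfolding H_def using g d(2) n by (auto simp: dist_real_def)
    then obtain h where h: "h \<in> D m n" "r m n g = r m n h" using D(3) by blast
    then have hH: "h \<in> H m n" using D(2) by blast
    have "\<bar>g w - h w\<bar> < e" if w: "w \<in> K" for w
    proof -
      obtain x where x: "x \<in> F n" "dist w x < 1 / real (Suc n)"
        using F(3) w by (force simp: dist_commute)
      have xK: "x \<in> K" using x F by blast
      have "\<lfloor>real (Suc m) * g x\<rfloor> = \<lfloor>real (Suc m) * h x\<rfloor>"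
        using h(2) x(1) unfolding r_def by (metis restrict_apply')
      then have "\<bar>real (Suc m) * g x - real (Suc m) * h x\<bar> < 1" by linarith
      then have "real (Suc m) * \<bar>g x - h x\<bar> < 1"
        by (simp add: abs_mult flip: right_diff_distrib del: of_nat_Suc)
      then have 1: "\<bar>g x - h x\<bar> < 1 / real (Suc m)" by (simp add: field_simps)
      have 2: "\<bar>g w - g x\<bar> < 1 / real (Suc m)" "\<bar>h w - h x\<bar> < 1 / real (Suc m)"
        using \<open>g \<in> H m n\<close> hH w xK x(2) unfolding H_def by auto
      show ?thesis using 1 2 m by linarith
    qed
    then show ?thesis using h(1) by blast
  qed
  moreover have "(\<Union>m n. D m n) \<subseteq> G" using D(2) unfolding H_def by blast
  moreover have "countable (\<Union>m n. D m n)" using D(1) by auto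
  ultimately show ?thesis by blast
qed

section \<open>Coding a compact metric space by real numbers\<close>

text \<open>At the first differing index \<open>n0\<close> the terms differ by
  \<open>(1/3) ^ n0\<close>, while all later terms together contribute at most half of that. In base
  2 the tail could cancel the leading term completely.\<close>

lemma suminf_ternary_digits_differ:
  fixes b b' :: "nat \<Rightarrow> real"
  assumes b: "\<And>k. b k \<in> {0, 1}" "\<And>k. b' k \<in> {0, 1}" and ne: "b n \<noteq> b' n"
  shows "(1/3) ^ n / 2 \<le> \<bar>(\<Sum>k. b k * (1/3) ^ k) - (\<Sum>k. b' k * (1/3) ^ k)\<bar>"
proof -
  define n0 where "n0 = (LEAST k. b k \<noteq> b' k)"
  have n0: "b n0 \<noteq> b' n0" "\<And>k. k < n0 \<Longrightarrow> b k = b' k" "n0 \<le> n"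
    unfolding n0_def using LeastI[of "\<lambda>k. b k \<noteq> b' k", OF ne] ne
    by (blast intro: Least_le dest: not_less_Least)+
  define a where "a k = (b k - b' k) * (1/3) ^ k" for k
  have geo: "summable (\<lambda>k. (1/3 :: real) ^ k)" by (simp add: summable_geometric)
  have ab: "\<bar>b k\<bar> \<le> 1" "\<bar>b' k\<bar> \<le> 1" "\<bar>b k - b' k\<bar> \<le> 1" for k
    using b(1)[of k] b(2)[of k] by auto
  have sb: "summable (\<lambda>k. b k * (1/3) ^ k)" "summable (\<lambda>k. b' k * (1/3) ^ k)"
    using ab by (auto intro!: summable_comparison_test'[OF geo] simp: abs_mult mult_le_cancel_right1)
  have sa: "summable a" unfolding a_def
    using summable_diff[OF sb] by (simp add: algebra_simps)
  have tail: "\<bar>\<Sum>k. a (k + Suc n0)\<bar> \<le> (1/3) ^ n0 / 2"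
  proof -
    have le: "\<bar>a (k + Suc n0)\<bar> \<le> (1/3) ^ Suc n0 * (1/3) ^ k" for k
      unfolding a_def using ab(3)[of "k + Suc n0"]
      by (auto simp: abs_mult power_add mult_le_cancel_right1)
    have s: "summable (\<lambda>k. (1/3 :: real) ^ Suc n0 * (1/3) ^ k)"
      using geo by (rule summable_mult)
    have sabs: "summable (\<lambda>k. \<bar>a (k + Suc n0)\<bar>)"
      by (rule summable_comparison_test'[OF s, of 0]) (use le in auto)
    have "\<bar>\<Sum>k. a (k + Suc n0)\<bar> \<le> (\<Sum>k. \<bar>a (k + Suc n0)\<bar>)" by (rule summable_rabs[OF sabs])
    also have "\<dots> \<le> (\<Sum>k. (1/3) ^ Suc n0 * (1/3) ^ k)" by (rule suminf_le[OF le sabs s])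
    also have "\<dots> = (1/3) ^ n0 / 2"
      unfolding suminf_mult[OF geo] by (simp add: suminf_geometric)
    finally show ?thesis .
  qed
  have "(\<Sum>k. b k * (1/3) ^ k) - (\<Sum>k. b' k * (1/3) ^ k) = suminf a"
    unfolding a_def using suminf_diff[OF sb] by (simp add: algebra_simps)
  also have "\<dots> = (\<Sum>k. a (k + Suc n0)) + (\<Sum>k<Suc n0. a k)"
    by (rule suminf_split_initial_segment[OF sa])
  also have "(\<Sum>k<Suc n0. a k) = a n0" using n0(2) by (simp add: a_def)
  finally have eq: "(\<Sum>k. b k * (1/3) ^ k) - (\<Sum>k. b' k * (1/3) ^ k) = (\<Sum>k. a (k + Suc n0)) + a n0" .
  have "\<bar>b n0 - b' n0\<bar> = 1" using b(1)[of n0] b(2)[of n0] n0(1) by auto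
  then have "\<bar>a n0\<bar> = (1/3) ^ n0" unfolding a_def by (simp add: abs_mult)
  then have "(1/3) ^ n0 / 2 \<le> \<bar>(\<Sum>k. a (k + Suc n0)) + a n0\<bar>" using tail by linarith
  moreover have "(1/3 :: real) ^ n \<le> (1/3) ^ n0" using n0(3) by (intro power_decreasing) auto
  ultimately show ?thesis unfolding eq by linarith
qed

text \<open>Digit \<open>k\<close> of \<open>h w\<close> records whether \<open>w\<close> lies in
  the \<open>k\<close>-th of countably many balls, centred at finite nets of all scales.
  Sufficiently close codes agree on all balls of a given scale, so a ball of that scale containing
  one point contains the other.\<close>

lemma compact_real_code:
  fixes K :: "'a::metric_space set"
  assumes K: "compact K"
  shows "\<exists>h :: 'a \<Rightarrow> real. h ` K \<subseteq> {0..2} \<and>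
    (\<forall>e>0. \<exists>d>0. \<forall>w\<in>K. \<forall>w'\<in>K. \<bar>h w - h w'\<bar> < d \<longrightarrow> dist w w' < e)"
proof -
  obtain F where F: "\<And>n. finite (F n)" "\<And>n. F n \<subseteq> K"
    "\<And>n. K \<subseteq> (\<Union>x\<in>F n. ball x (1 / real (Suc n)))"
    using compact_finite_nets[OF K] by blast
  define S where "S = Sigma UNIV F"
  have S: "countable S" unfolding S_def 
    by (intro countable_SIGMA countableI_type countable_finite F(1))
  \<comment> \<open>For empty \<open>K\<close> the set \<open>S\<close> is empty and
    \<open>c\<close> takes arbitrary values; the separation claim is then vacuous.\<close>
  define c where "c = from_nat_into S"
  define b where "b w k = (if dist (snd (c k)) w < 1 / real (Suc (fst (c k))) then 1 else 0 :: real)" for w k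
  define h where "h w = (\<Sum>k. b w k * (1/3) ^ k)" for w
  have b01: "b w k \<in> {0, 1}" for w k by (auto simp: b_def)
  have geo: "summable (\<lambda>k. (1/3 :: real) ^ k)" by (simp add: summable_geometric)
  have sb: "summable (\<lambda>k. b w k * (1/3) ^ k)" for w
    by (rule summable_comparison_test'[OF geo, of 0]) (auto simp: b_def)
  have "h w \<in> {0..2}" for w
  proof -
    have "h w \<le> (\<Sum>k. (1/3) ^ k)" unfolding h_def
      by (rule suminf_le[OF _ sb geo]) (auto simp: b_def)
    moreover have "0 \<le> h w" unfolding h_def by (rule suminf_nonneg[OF sb]) (auto simp: b_def)
    ultimately show ?thesis by (simp add: suminf_geometric)
  qed
  moreover have "\<exists>d>0. \<forall>w\<in>K. \<forall>w'\<in>K. \<bar>h w - h w'\<bar> < d \<longrightarrow> dist w w' < e" if e: "e > 0" for e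
  proof -
    obtain n where n: "1 / real (Suc n) < e / 2"
      using e nat_approx_posE[of "e / 2"] by auto
    have "\<forall>x\<in>F n. \<exists>k. c k = (n, x)"
      using from_nat_into_surj[OF S] unfolding c_def S_def by blast
    then obtain k where k: "\<And>x. x \<in> F n \<Longrightarrow> c (k x) = (n, x)" by metis
    \<comment> \<open>\<open>N\<close> bounds the indices of all balls of scale \<open>n\<close>, so
      the tolerance \<open>(1/3) ^ N / 2\<close> forces their digits to agree. Inserting
      \<open>0\<close> covers an empty net.\<close>
    define N where "N = Max (insert 0 (k ` F n))"
    have N: "k x \<le> N" if "x \<in> F n" for x unfolding N_def using F(1) that by (auto intro: Max_ge)
    have "dist w w' < e" if w: "w \<in> K" "w' \<in> K" and d: "\<bar>h w - h w'\<bar> < (1/3) ^ N / 2" for w w'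
    proof -
      obtain x where x: "x \<in> F n" "dist x w < 1 / real (Suc n)"
        using F(3) w(1) by force
      have "b w (k x) = b w' (k x)"
      proof (rule ccontr)
        assume "b w (k x) \<noteq> b w' (k x)"
        then have "(1/3) ^ k x / 2 \<le> \<bar>h w - h w'\<bar>"
          unfolding h_def by (intro suminf_ternary_digits_differ b01)
        moreover have "(1/3 :: real) ^ N \<le> (1/3) ^ k x" using N[OF x(1)] by (intro power_decreasing) auto
        ultimately show False using d by linarith
      qed
      then have "dist x w' < 1 / real (Suc n)"
        using k[OF x(1)] x(2) unfolding b_def by (auto split: if_splits)
      then show ?thesis using x(2) n dist_triangle2[of w w' x] by (simp add: dist_commute)
    qed
    then show ?thesis by (intro exI[of _ "(1/3) ^ N / 2"]) auto
  qed
  ultimately show ?thesis by (intro exI[of _ h]) auto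
qed

text \<open>
  \<open>h\<close> need not be continuous. Its inverse \<open>\<phi>\<close> extends to the closure of \<open>h ` K\<close> because the
  closure \<open>\<Gamma>\<close> of the graph of \<open>h\<close> is compact and projects injectively to the reals.
\<close>

lemma compact_image_of_real_compact:
  fixes K :: "'a::metric_space set"
  assumes K: "compact K"
  shows "\<exists>(L :: real set) \<phi> h. compact L \<and> continuous_on L \<phi> \<and> \<phi> ` L \<subseteq> K \<and>
    (\<forall>w\<in>K. h w \<in> L \<and> \<phi> (h w) = w)"
proof -
  obtain h :: "'a \<Rightarrow> real" where h: "h ` K \<subseteq> {0..2}"
    "\<And>e. e > 0 \<Longrightarrow> \<exists>d>0. \<forall>w\<in>K. \<forall>w'\<in>K. \<bar>h w - h w'\<bar> < d \<longrightarrow> dist w w' < e"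
    using compact_real_code[OF K] by blast
  define \<Gamma> where "\<Gamma> = closure ((\<lambda>w. (h w, w)) ` K)"
  have "closed ({0..2 :: real} \<times> K)" using K by (simp add: closed_Times compact_imp_closed)
  moreover have "(\<lambda>w. (h w, w)) ` K \<subseteq> {0..2} \<times> K" using h(1) by auto
  ultimately have sub: "\<Gamma> \<subseteq> {0..2} \<times> K" unfolding \<Gamma>_def by (rule closure_minimal[rotated])
  have "compact ({0..2 :: real} \<times> K)" using K by (simp add: compact_Times)
  then have "compact (({0..2} \<times> K) \<inter> \<Gamma>)" unfolding \<Gamma>_def by (rule compact_Int_closed) simp
  then have cG: "compact \<Gamma>" using sub by (simp add: Int_absorb1)
  have inj: "inj_on fst \<Gamma>"
  proof (rule inj_onI)
    fix z z' assume z: "z \<in> \<Gamma>" "z' \<in> \<Gamma>" and eq: "fst z = fst z'"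
    have "dist (snd z) (snd z') \<le> e" if e: "e > 0" for e
    proof -
      obtain d where d: "d > 0" "\<forall>w\<in>K. \<forall>w'\<in>K. \<bar>h w - h w'\<bar> < d \<longrightarrow> dist w w' < e / 3"
        using h(2)[of "e / 3"] e by auto
      \<comment> \<open>Two errors below \<open>d / 2\<close> keep the codes of the nearby graph
        points within \<open>d\<close>; two errors below \<open>e / 3\<close> and the distance of
        these points in \<open>K\<close> then add up to less than \<open>e\<close>.\<close>
      define r where "r = min (d / 2) (e / 3)"
      have r: "r > 0" using d e by (simp add: r_def)
      obtain w where w: "w \<in> K" "dist (h w, w) z < r"
        using z(1) r unfolding \<Gamma>_def closure_approachable by blast
      obtain w' where w': "w' \<in> K" "dist (h w', w') z' < r"
        using z(2) r unfolding \<Gamma>_def closure_approachable by blast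
      have 1: "dist (h w) (fst z) < r" "dist w (snd z) < r" "dist (h w') (fst z') < r" "dist w' (snd z') < r"
        using w(2) w'(2) dist_fst_le[of "(h w, w)" z] dist_snd_le[of "(h w, w)" z]
          dist_fst_le[of "(h w', w')" z'] dist_snd_le[of "(h w', w')" z'] by auto
      then have "\<bar>h w - h w'\<bar> < d" using eq unfolding r_def dist_real_def by linarith
      then have "dist w w' < e / 3" using d w(1) w'(1) by blast
      moreover have "dist (snd z) (snd z') \<le> dist w (snd z) + dist w w' + dist w' (snd z')"
        using dist_triangle[of "snd z" "snd z'" w] dist_triangle[of w "snd z'" w']
        by (simp add: dist_commute)
      ultimately show ?thesis using 1 unfolding r_def by linarith
    qed
    then have "dist (snd z) (snd z') \<le> 0" by (rule field_le_epsilon[of _ 0, simplified])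
    then show "z = z'" using eq by (simp add: prod_eq_iff)
  qed
  define \<phi> where "\<phi> = snd \<circ> the_inv_into \<Gamma> fst"
  have \<phi>_fst: "\<phi> (fst z) = snd z" if "z \<in> \<Gamma>" for z
    unfolding \<phi>_def o_def the_inv_into_f_f[OF inj that] ..
  have "continuous_on (fst ` \<Gamma>) (the_inv_into \<Gamma> fst)"
    by (rule continuous_on_inv_into[OF _ cG inj]) (intro continuous_intros)
  then have c1: "continuous_on (fst ` \<Gamma>) \<phi>" unfolding \<phi>_def o_def by (rule continuous_on_snd)
  have c2: "compact (fst ` \<Gamma>)"
    by (rule compact_continuous_image[OF _ cG]) (intro continuous_intros)
  have c3: "\<phi> ` (fst ` \<Gamma>) \<subseteq> K"
  proof
    fix t assume "t \<in> \<phi> ` (fst ` \<Gamma>)"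
    then obtain z where z: "z \<in> \<Gamma>" "t = \<phi> (fst z)" by blast
    then show "t \<in> K" using \<phi>_fst[OF z(1)] subsetD[OF sub z(1)] by auto
  qed
  have c4: "h w \<in> fst ` \<Gamma>" "\<phi> (h w) = w" if "w \<in> K" for w
  proof -
    have "(h w, w) \<in> (\<lambda>w. (h w, w)) ` K" using that by (rule imageI)
    then have mem: "(h w, w) \<in> \<Gamma>" unfolding \<Gamma>_def by (rule subsetD[OF closure_subset])
    show "h w \<in> fst ` \<Gamma>" "\<phi> (h w) = w" using imageI[OF mem, of fst] \<phi>_fst[OF mem] by simp_all
  qed
  show ?thesis
    by (intro exI[of _ "fst ` \<Gamma>"] exI[of _ \<phi>] exI[of _ h] conjI ballI c1 c2 c3 c4)
qed

section \<open>Regular measures and weak limits on \<open>K\<close>\<close>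

text \<open>Inner regularity is transported from the line: compact subsets of \<open>L\<close>
  inside the preimage of \<open>A\<close> have compact images inside \<open>A\<close>. Outer
  regularity follows by complements, since removing a compact set from \<open>K\<close> leaves a
  relatively open set.\<close>

lemma regular_borel_prob_on_distr:
  fixes K :: "'a::metric_space set" and \<phi> :: "real \<Rightarrow> 'a"
  assumes K: "compact K" and L: "compact L" and cont: "continuous_on L \<phi>"
    and N: "real_distribution N" "AE x in N. x \<in> L"
    and meas: "\<phi> \<in> measurable borel (restrict_space borel K)"
  shows "regular_borel_prob_on K (distr N (restrict_space borel K) \<phi>)"
proof -
  interpret N: real_distribution N by fact
  define R where "R = restrict_space (borel :: 'a measure) K"
  define \<mu> where "\<mu> = distr N R \<phi>"
  have mN: "\<phi> \<in> measurable N R" using meas unfolding R_def by simp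
  have spR: "space R = K" unfolding R_def by (simp add: space_restrict_space)
  have Kb: "K \<in> sets borel" using K by (simp add: borel_closed compact_imp_closed)
  have setsR: "A \<in> sets R \<longleftrightarrow> A \<subseteq> K \<and> A \<in> sets borel" for A
    unfolding R_def by (rule sets_restrict_space_iff) (use Kb in simp)
  interpret \<mu>: prob_space \<mu> unfolding \<mu>_def by (rule N.prob_space_distr[OF mN])
  have sets\<mu>: "sets \<mu> = sets R" and sp\<mu>: "space \<mu> = K" by (simp_all add: \<mu>_def spR)
  have cmp: "Q \<in> sets R" if "compact Q" "Q \<subseteq> K" for Q
    using that by (simp add: setsR borel_closed compact_imp_closed)
  have inner: "\<exists>Q\<in>{Q. compact Q \<and> Q \<subseteq> A}. emeasure \<mu> A \<le> emeasure \<mu> Q + ennreal e"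
    if A: "A \<in> sets R" and e: "e > 0" for A and e :: real
  proof -
    \<comment> \<open>Intersecting with \<open>L\<close> loses no mass, and \<open>\<phi>\<close> is
      continuous on \<open>L\<close>, which makes images of compact subsets of \<open>B\<close>
      compact.\<close>
    define B where "B = \<phi> -` A \<inter> L"
    have vA: "\<phi> -` A \<in> sets borel" using measurable_sets[OF mN A] by simp
    have B: "B \<in> sets borel" unfolding B_def using vA L by (auto intro: borel_closed compact_imp_closed)
    have "emeasure \<mu> A = emeasure N (\<phi> -` A)"
      unfolding \<mu>_def using emeasure_distr[OF mN A] by simp
    also have "\<dots> = emeasure N B"
      using N(2) vA B by (intro emeasure_eq_AE) (auto simp: B_def)
    also have "\<dots> = (SUP Q\<in>{Q. Q \<subseteq> B \<and> compact Q}. emeasure N Q)"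
      by (rule inner_regular) (auto simp: B)
    finally have eq: "emeasure \<mu> A = (SUP Q\<in>{Q. Q \<subseteq> B \<and> compact Q}. emeasure N Q)" .
    have "\<exists>Q\<in>{Q. Q \<subseteq> B \<and> compact Q}. emeasure \<mu> A < emeasure N Q + ennreal e"
      by (rule SUP_approx_ennreal[OF _ _ eq]) (use e \<mu>.emeasure_finite[of A] in \<open>auto intro!: exI[of _ "{}"]\<close>)
    then obtain Q where Q: "Q \<subseteq> B" "compact Q" "emeasure \<mu> A < emeasure N Q + ennreal e" by blast
    have im: "compact (\<phi> ` Q)" "\<phi> ` Q \<subseteq> A"
      using Q cont unfolding B_def by (auto intro: compact_continuous_image continuous_on_subset)
    then have R: "\<phi> ` Q \<in> sets R" using cmp A setsR by blast
    have "emeasure N Q \<le> emeasure N (\<phi> -` (\<phi> ` Q))"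
      using measurable_sets[OF mN R] by (intro emeasure_mono) auto
    also have "\<dots> = emeasure \<mu> (\<phi> ` Q)"
      unfolding \<mu>_def using emeasure_distr[OF mN R] by simp
    finally have "emeasure \<mu> A \<le> emeasure \<mu> (\<phi> ` Q) + ennreal e"
      using Q(3) by (meson add_right_mono less_imp_le order_trans)
    then show ?thesis using im by blast
  qed
  have outer: "\<exists>U\<in>{U. openin (top_of_set K) U \<and> A \<subseteq> U}. emeasure \<mu> U \<le> emeasure \<mu> A + ennreal e"
    if A: "A \<in> sets R" and e: "e > 0" for A and e :: real
  proof -
    have "K - A \<in> sets R" using A sets.compl_sets[OF A] spR by simp
    from inner[OF this e] obtain Q where Q: "compact Q" "Q \<subseteq> K - A"
      "emeasure \<mu> (K - A) \<le> emeasure \<mu> Q + ennreal e" by auto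
    have QR: "Q \<in> sets R" using cmp Q by blast
    have "measure \<mu> (K - A) \<le> measure \<mu> Q + e"
      using Q(3) e by (simp add: \<mu>.emeasure_eq_measure flip: ennreal_plus)
    then have "measure \<mu> (K - Q) \<le> measure \<mu> A + e"
      using \<mu>.prob_compl[of A] \<mu>.prob_compl[of Q] A QR sp\<mu> sets\<mu> by simp
    then have "emeasure \<mu> (K - Q) \<le> emeasure \<mu> A + ennreal e"
      using e by (simp add: \<mu>.emeasure_eq_measure flip: ennreal_plus)
    moreover have "openin (top_of_set K) (K - Q)"
      using Q by (auto simp: openin_open Diff_eq compact_imp_closed intro!: exI[of _ "- Q"])
    moreover have "A \<subseteq> K - Q" using Q A setsR by blast
    ultimately show ?thesis by blast
  qed
  have "emeasure \<mu> A = (SUP Q\<in>{Q. compact Q \<and> Q \<subseteq> A}. emeasure \<mu> Q) \<and>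
        emeasure \<mu> A = (INF U\<in>{U. openin (top_of_set K) U \<and> A \<subseteq> U}. emeasure \<mu> U)"
    if A: "A \<in> sets \<mu>" for A
  proof
    have AR: "A \<in> sets R" using A sets\<mu> by simp
    show "emeasure \<mu> A = (SUP Q\<in>{Q. compact Q \<and> Q \<subseteq> A}. emeasure \<mu> Q)"
      by (intro ennreal_approx_SUP inner[OF AR]) (auto intro: emeasure_mono A)
    have "U \<in> sets \<mu>" if "openin (top_of_set K) U" for U
      using that Kb unfolding sets\<mu> setsR openin_open by auto
    then show "emeasure \<mu> A = (INF U\<in>{U. openin (top_of_set K) U \<and> A \<subseteq> U}. emeasure \<mu> U)"
      by (intro ennreal_approx_INF outer[OF AR]) (auto intro: emeasure_mono)
  qed
  then show ?thesis
    using \<mu>.prob_space_axioms sp\<mu> sets\<mu>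
    unfolding regular_borel_prob_on_def \<mu>_def R_def by blast
qed

text \<open>Since \<open>\<phi> (h w) = w\<close> on \<open>K\<close>, expectations of
  \<open>g\<close> turn into expectations of \<open>g \<circ> \<phi>\<close> under the lifted
  measures. This composite is continuous on \<open>L\<close> even where \<open>h\<close> is not
  continuous, so weak convergence on the line applies to it.\<close>

lemma pmf_weak_limit_on_compact:
  fixes K :: "'a::metric_space set" and P :: "nat \<Rightarrow> 'a pmf"
  assumes K: "compact K" and P: "\<And>n. set_pmf (P n) \<subseteq> K"
  shows "\<exists>r \<mu>. strict_mono r \<and> regular_borel_prob_on K \<mu> \<and>
    (\<forall>g :: 'a \<Rightarrow> real. continuous_on K g \<longrightarrow>
      (\<lambda>n. measure_pmf.expectation (P (r n)) g) \<longlonglongrightarrow> (\<integral>w. g w \<partial>\<mu>))"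
proof -
  have Kne: "K \<noteq> {}" using P[of 0] set_pmf_not_empty by fastforce
  obtain L :: "real set" and \<phi> h where L: "compact L" "continuous_on L \<phi>" "\<And>x. x \<in> L \<Longrightarrow> \<phi> x \<in> K"
    and h: "\<And>w. w \<in> K \<Longrightarrow> h w \<in> L" "\<And>w. w \<in> K \<Longrightarrow> \<phi> (h w) = w"
    using compact_image_of_real_compact[OF K] unfolding image_subset_iff by blast
  obtain w0 where w0: "w0 \<in> K" using Kne by blast
  have Lne: "L \<noteq> {}" using h(1)[OF w0] by blast
  have Lcl: "closed L" using L compact_imp_closed by blast
  \<comment> \<open>Measurability of \<open>h\<close> is automatic here, because every set is
    measurable for \<open>measure_pmf\<close>.\<close>
  define N where "N n = distr (measure_pmf (P n)) borel h" for n
  have Nd: "real_distribution (N n)" for n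
    unfolding N_def by (rule prob_space.real_distribution_distr[OF prob_space_measure_pmf]) simp
  have Nint: "(\<integral>x. f x \<partial>N n) = measure_pmf.expectation (P n) (\<lambda>w. f (h w))"
    if "f \<in> borel_measurable borel" for f :: "real \<Rightarrow> real" and n
    unfolding N_def by (rule integral_distr) (use that in auto)
  have "bounded L" using L compact_imp_bounded by blast
  then obtain a where a: "\<And>x. x \<in> L \<Longrightarrow> \<bar>x\<bar> \<le> a" unfolding bounded_real by blast
  \<comment> \<open>Tightness is stated with half-open intervals; the added \<open>1\<close> keeps
    the left end strictly below \<open>L\<close> and the interval nonempty.\<close>
  define b where "b = \<bar>a\<bar> + 1"
  have full: "measure (N n) {- b <.. b} = 1" for n
  proof -
    interpret real_distribution "N n" by (rule Nd)
    have "AE w in measure_pmf (P n). h w \<in> {- b <.. b}"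
    proof (rule AE_pmfI)
      fix w assume "w \<in> set_pmf (P n)"
      then have "\<bar>h w\<bar> \<le> a" using P h(1) a by blast
      then show "h w \<in> {- b <.. b}" unfolding b_def by auto
    qed
    then have "AE x in N n. x \<in> {- b <.. b}" unfolding N_def by (subst AE_distr_iff) auto
    then show ?thesis using prob_eq_1[of "{- b <.. b}"] by simp
  qed
  have "\<exists>a b :: real. a < b \<and> (\<forall>n. measure (N n) {a <.. b} > 1 - e)" if "e > 0" for e :: real
    using full that by (intro exI[of _ "- b"] exI[of _ b]) (simp add: b_def)
  then have "tight N" unfolding tight_def using Nd by blast
  from tight_imp_convergent_subsubsequence[OF this strict_mono_id]
  obtain r \<nu> where r: "strict_mono r" and \<nu>: "real_distribution \<nu>"
    and wc: "weak_conv_m (N \<circ> id \<circ> r) \<nu>" by blast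
  interpret \<nu>: real_distribution \<nu> by (rule \<nu>)
  have lim: "(\<lambda>n. measure_pmf.expectation (P (r n)) (\<lambda>w. f (h w))) \<longlonglongrightarrow> (\<integral>x. f x \<partial>\<nu>)"
    if f: "continuous_on UNIV f" "\<And>x. \<bar>f x\<bar> \<le> B" for f :: "real \<Rightarrow> real" and B
  proof -
    have "(\<lambda>n. \<integral>x. f x \<partial>((N \<circ> id \<circ> r) n)) \<longlonglongrightarrow> (\<integral>x. f x \<partial>\<nu>)"
      by (rule weak_conv_imp_integral_bdd_continuous_conv[OF _ \<nu> wc, of f B])
        (use f Nd in \<open>auto simp: continuous_on_eq_continuous_at\<close>)
    then show ?thesis using Nint[of f] f(1) by (simp add: borel_measurable_continuous_onI)
  qed
  \<comment> \<open>Testing the weak convergence against \<open>q\<close> shows that the limit is carried by \<open>L\<close>.\<close>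
  define q where "q x = min 1 (infdist x L)" for x
  have qc: "continuous_on UNIV q" unfolding q_def by (intro continuous_intros)
  have qb: "0 \<le> q x" "\<bar>q x\<bar> \<le> 1" for x unfolding q_def by (auto simp: infdist_nonneg)
  have qm: "q \<in> borel_measurable borel" by (rule borel_measurable_continuous_onI[OF qc])
  have q0: "q x = 0" if "x \<in> L" for x using that by (simp add: q_def)
  have "measure_pmf.expectation (P n) (\<lambda>w. q (h w)) = 0" for n
  proof -
    have "measure_pmf.expectation (P n) (\<lambda>w. q (h w)) = measure_pmf.expectation (P n) (\<lambda>w. 0)"
      by (intro integral_cong_AE AE_pmfI q0 h(1) subsetD[OF P]) auto
    then show ?thesis by simp
  qed
  then have "(\<integral>x. q x \<partial>\<nu>) = 0" using lim[OF qc qb(2)] by (simp add: LIMSEQ_const_iff)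
  moreover have "integrable \<nu> q"
    by (rule \<nu>.integrable_const_bound[of _ 1]) (use qb qm in auto)
  ultimately have "AE x in \<nu>. q x = 0"
    using integral_nonneg_eq_0_iff_AE[of \<nu> q] qb by auto
  then have AE: "AE x in \<nu>. x \<in> L"
    by (rule AE_mp) (auto simp: q_def min_def in_closed_iff_infdist_zero[OF Lcl Lne] split: if_splits)
  \<comment> \<open>The default \<open>w0\<close> off \<open>L\<close>, a null set of
    \<open>\<nu>\<close>, makes the map take values in \<open>K\<close> everywhere.\<close>
  define \<psi> where "\<psi> x = (if x \<in> L then \<phi> x else w0)" for x
  have \<psi>m0: "\<psi> \<in> borel_measurable borel" unfolding \<psi>_def
    using Lcl L by (intro borel_measurable_continuous_on_if) (auto intro: borel_closed)
  then have \<psi>m: "\<psi> \<in> measurable borel (restrict_space borel K)"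
    using L(3) w0 by (intro measurable_restrict_space2) (auto simp: \<psi>_def)
  have \<psi>c: "continuous_on L \<psi>" using L(2) by (rule continuous_on_eq) (simp add: \<psi>_def)
  define \<mu> where "\<mu> = distr \<nu> (restrict_space borel K) \<psi>"
  have reg: "regular_borel_prob_on K \<mu>" unfolding \<mu>_def
    by (rule regular_borel_prob_on_distr[OF K L(1) \<psi>c \<nu> AE \<psi>m])
  have "(\<lambda>n. measure_pmf.expectation (P (r n)) g) \<longlonglongrightarrow> (\<integral>w. g w \<partial>\<mu>)"
    if g: "continuous_on K g" for g :: "'a \<Rightarrow> real"
  proof -
    have gc: "continuous_on L (\<lambda>x. g (\<psi> x))"
      using \<psi>c L(3) by (intro continuous_on_compose2[OF g]) (auto simp: \<psi>_def)
    have "bounded (g ` K)" using compact_continuous_image[OF g K] compact_imp_bounded by blast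
    then obtain B where B: "\<And>w. w \<in> K \<Longrightarrow> \<bar>g w\<bar> \<le> B" unfolding bounded_real by blast
    have B0: "0 \<le> B" using B[OF w0] by linarith
    \<comment> \<open>Weak convergence needs a bounded continuous test function on the whole line,
      so the composite is extended from the closed set \<open>L\<close> with the same bound.\<close>
    obtain G where G: "continuous_on UNIV G" "\<And>x. x \<in> L \<Longrightarrow> G x = g (\<psi> x)"
      "\<And>x. x \<in> UNIV \<Longrightarrow> norm (G x) \<le> B"
      by (rule Tietze[of L "\<lambda>x. g (\<psi> x)" UNIV B])
        (use gc Lcl B0 B L(3) in \<open>auto simp: \<psi>_def\<close>)
    have "(\<integral>w. g w \<partial>\<mu>) = (\<integral>x. g (\<psi> x) \<partial>\<nu>)" unfolding \<mu>_def
      by (rule integral_distr) (use \<psi>m g in \<open>auto intro: borel_measurable_continuous_on_restrict\<close>)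
    also have "\<dots> = (\<integral>x. G x \<partial>\<nu>)"
    proof (rule integral_cong_AE)
      show "(\<lambda>x. g (\<psi> x)) \<in> borel_measurable \<nu>"
        using measurable_compose[OF \<psi>m borel_measurable_continuous_on_restrict[OF g]] by simp
      show "G \<in> borel_measurable \<nu>" using borel_measurable_continuous_onI[OF G(1)] by simp
      show "AE x in \<nu>. g (\<psi> x) = G x" using AE by (rule AE_mp) (auto simp: G(2))
    qed
    finally have 1: "(\<integral>w. g w \<partial>\<mu>) = (\<integral>x. G x \<partial>\<nu>)" .
    have 2: "measure_pmf.expectation (P n) g = measure_pmf.expectation (P n) (\<lambda>w. G (h w))" for n
      using P h G(2) by (intro integral_cong_AE) (auto intro!: AE_pmfI simp: \<psi>_def subset_iff)
    show ?thesis unfolding 1 2 using lim[OF G(1), of B] G(3) by simp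
  qed
  then show ?thesis using r reg by blast
qed

section \<open>From finite to arbitrary families of continuous functions\<close>

lemma integrable_continuous_regular_borel_prob_on:
  fixes K :: "'a::metric_space set" and g :: "'a \<Rightarrow> real"
  assumes K: "compact K" and \<mu>: "regular_borel_prob_on K \<mu>" and g: "continuous_on K g"
  shows "integrable \<mu> g"
proof -
  interpret prob_space \<mu> using \<mu> unfolding regular_borel_prob_on_def by blast
  have sp: "space \<mu> = K" and st: "sets \<mu> = sets (restrict_space borel K)"
    using \<mu> unfolding regular_borel_prob_on_def by blast+
  have "bounded (g ` K)" using compact_continuous_image[OF g K] compact_imp_bounded by blast
  then obtain B where B: "\<And>w. w \<in> K \<Longrightarrow> \<bar>g w\<bar> \<le> B" unfolding bounded_real by blast
  have "g \<in> borel_measurable \<mu>"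
    using borel_measurable_continuous_on_restrict[OF g] measurable_cong_sets[OF st refl] by blast
  then show ?thesis
    by (intro integrable_const_bound[of _ B]) (auto simp: sp B)
qed

text \<open>The finite sets \<open>E n\<close> increase to the dense set \<open>D\<close>, and
  \<open>P n\<close> serves \<open>E n\<close> with tolerance \<open>1 / Suc n\<close>. Each member
  of \<open>D\<close> lies in all later \<open>E n\<close>, so its integral under the weak limit is
  nonnegative; uniform approximation extends this to \<open>G\<close>.\<close>

lemma exists_measure_nonneg_integrals:
  fixes K :: "'a::metric_space set" and G :: "('a \<Rightarrow> real) set"
  assumes K: "compact K" and cont: "\<And>g. g \<in> G \<Longrightarrow> continuous_on K g"
    and hyp: "\<And>gs. set gs \<subseteq> G \<Longrightarrow> \<exists>w\<in>K. 0 \<le> (\<Sum>g\<leftarrow>gs. g w)"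
  shows "\<exists>\<mu>. regular_borel_prob_on K \<mu> \<and> (\<forall>g\<in>G. 0 \<le> (\<integral>w. g w \<partial>\<mu>))"
proof -
  obtain D where D: "D \<subseteq> G" "countable D"
    and dense: "\<And>g e. g \<in> G \<Longrightarrow> e > 0 \<Longrightarrow> \<exists>h\<in>D. \<forall>w\<in>K. \<bar>g w - h w\<bar> < e"
    using countable_uniformly_dense_subset[OF K cont] by metis
  define E where "E n = {g \<in> D. to_nat_on D g \<le> n}" for n
  have "\<exists>P. set_pmf P \<subseteq> K \<and> (\<forall>g\<in>E n. - (1 / real (Suc n)) \<le> measure_pmf.expectation P g)" for n
  proof -
    have "finite (to_nat_on D ` E n)" unfolding E_def by (rule finite_subset[of _ "{..n}"]) auto
    moreover have "inj_on (to_nat_on D) (E n)"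
      using inj_on_to_nat_on[OF D(2)] by (rule inj_on_subset) (auto simp: E_def)
    ultimately have fin: "finite (E n)" by (rule finite_imageD)
    have EG: "E n \<subseteq> G" using D(1) unfolding E_def by blast
    have "bounded (\<Union>g\<in>E n. g ` K)"
      using fin EG K cont by (intro bounded_UN ballI compact_imp_bounded compact_continuous_image) auto
    then obtain B where B: "\<And>g w. g \<in> E n \<Longrightarrow> w \<in> K \<Longrightarrow> \<bar>g w\<bar> \<le> B"
      unfolding bounded_real by blast
    show ?thesis
      by (rule finite_family_expectation[of _ _ B]) (use fin B hyp EG in \<open>auto 0 3\<close>)
  qed
  then obtain P where P: "\<And>n. set_pmf (P n) \<subseteq> K"
    "\<And>n g. g \<in> E n \<Longrightarrow> - (1 / real (Suc n)) \<le> measure_pmf.expectation (P n) g" by metis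
  obtain r \<mu> where r: "strict_mono r" and \<mu>: "regular_borel_prob_on K \<mu>"
    and lim: "\<And>g :: 'a \<Rightarrow> real. continuous_on K g \<Longrightarrow>
      (\<lambda>n. measure_pmf.expectation (P (r n)) g) \<longlonglongrightarrow> (\<integral>w. g w \<partial>\<mu>)"
    using pmf_weak_limit_on_compact[OF K, of P] P(1) by blast
  interpret prob_space \<mu> using \<mu> unfolding regular_borel_prob_on_def by blast
  have sp: "space \<mu> = K" using \<mu> unfolding regular_borel_prob_on_def by blast
  have pos: "0 \<le> (\<integral>w. h w \<partial>\<mu>)" if h: "h \<in> D" for h
  proof (rule LIMSEQ_le[OF _ lim])
    show "continuous_on K h" using h D cont by blast
    show "(\<lambda>n. - (1 / real (Suc n))) \<longlonglongrightarrow> 0"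
      using tendsto_minus[OF LIMSEQ_inverse_real_of_nat] by (simp add: inverse_eq_divide)
    show "\<exists>N. \<forall>n\<ge>N. - (1 / real (Suc n)) \<le> measure_pmf.expectation (P (r n)) h"
    proof (intro exI[of _ "to_nat_on D h"] allI impI)
      fix n assume n: "to_nat_on D h \<le> n"
      have rn: "n \<le> r n" by (rule strict_mono_imp_increasing[OF r])
      then have "h \<in> E (r n)" using n h unfolding E_def by auto
      then have "- (1 / real (Suc (r n))) \<le> measure_pmf.expectation (P (r n)) h" by (rule P(2))
      moreover have "1 / real (Suc (r n)) \<le> 1 / real (Suc n)"
        using rn by (intro divide_left_mono) auto
      ultimately show "- (1 / real (Suc n)) \<le> measure_pmf.expectation (P (r n)) h" by linarith
    qed
  qed
  have "0 \<le> (\<integral>w. g w \<partial>\<mu>)" if g: "g \<in> G" for g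
  proof (rule field_le_epsilon)
    fix e :: real assume e: "e > 0"
    obtain h where h: "h \<in> D" "\<And>w. w \<in> K \<Longrightarrow> \<bar>g w - h w\<bar> < e" using dense[OF g e] by blast
    have gi: "integrable \<mu> g"
      using integrable_continuous_regular_borel_prob_on[OF K \<mu> cont[OF g]] .
    have hi: "integrable \<mu> h"
      using integrable_continuous_regular_borel_prob_on[OF K \<mu> cont] h D by blast
    have "(\<integral>w. h w \<partial>\<mu>) \<le> (\<integral>w. g w + e \<partial>\<mu>)"
      using h(2) gi hi by (intro integral_mono) (fastforce simp: sp)+
    also have "\<dots> = (\<integral>w. g w \<partial>\<mu>) + e" using gi by (simp add: prob_space)
    finally show "0 \<le> (\<integral>w. g w \<partial>\<mu>) + e" using pos[OF h(1)] by linarith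
  qed
  then show ?thesis using \<mu> by blast
qed

section \<open>The two conditions and the Lipschitz bound\<close>

lemma continuous_on_abs_dist_diff_powr:
  fixes p :: real
  assumes "1 \<le> p"
  shows "continuous_on K (\<lambda>w. \<bar>dist x w - dist y w\<bar> powr p)"
  using assms by (intro continuous_on_powr' continuous_intros) auto

text \<open>Taking \<open>p\<close>-th powers makes the inequality linear in the integral, the form
  needed both for summing over pairs and for reading it as nonnegativity of an integral.\<close>

lemma eccentric_dominated_iff_powr:
  fixes K :: "'a::metric_space set" and f :: "'a \<Rightarrow> real"
  assumes "1 \<le> p" "C > 0"
  shows "eccentric_dominated p C K f \<longleftrightarrow> (\<exists>\<mu>. regular_borel_prob_on K \<mu> \<and>
    (\<forall>x y. \<bar>f x - f y\<bar> powr p \<le> C powr p * (\<integral>w. \<bar>dist x w - dist y w\<bar> powr p \<partial>\<mu>)))"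
proof -
  have "a \<le> C * b powr (1 / p) \<longleftrightarrow> a powr p \<le> C powr p * b" if "0 \<le> a" "0 \<le> b" for a b :: real
  proof -
    have "a \<le> C * b powr (1 / p) \<longleftrightarrow> a powr p \<le> (C * b powr (1 / p)) powr p"
      using that assms powr_mono2[of p a "C * b powr (1 / p)"]
        powr_less_mono2[of p "C * b powr (1 / p)" a] by (force simp: not_le[symmetric])
    also have "(C * b powr (1 / p)) powr p = C powr p * b"
      using that assms by (simp add: powr_mult powr_powr)
    finally show ?thesis .
  qed
  then show ?thesis unfolding eccentric_dominated_def by simp
qed

text \<open>By compactness the supremum in (i) is attained at a maximiser of \<open>S\<close>; this
  is the point of \<open>K\<close> at which the given finite sum is nonnegative.\<close>

lemma eccentric_finite_sums_imp_dominated: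
  fixes K :: "'a::metric_space set"
  assumes K: "compact K" "K \<noteq> {}" and p: "1 \<le> p" and C: "C > 0"
    and sums: "eccentric_finite_sums p C K f"
  shows "eccentric_dominated p C K f"
proof -
  define g where "g z w = C powr p * \<bar>dist (fst z) w - dist (snd z) w\<bar> powr p
      - \<bar>f (fst z) - f (snd z)\<bar> powr p" for z :: "'a \<times> 'a" and w
  have gc: "continuous_on K (g z)" for z
    unfolding g_def using p by (intro continuous_intros continuous_on_abs_dist_diff_powr)
  have "\<exists>w\<in>K. 0 \<le> (\<Sum>h\<leftarrow>gs. h w)" if gs: "set gs \<subseteq> range g" for gs
  proof -
    obtain zs where zs: "gs = map g zs" using gs ex_map_conv[of gs g] by blast
    define n where "n = length zs"
    \<comment> \<open>Lists are indexed from 0 and the sums in (i) from 1, hence the shift.\<close>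
    define x where "x i = fst (zs ! (i - 1))" for i
    define y where "y i = snd (zs ! (i - 1))" for i
    define S where "S w = (\<Sum>i=1..n. \<bar>dist (x i) w - dist (y i) w\<bar> powr p)" for w
    have S0: "0 \<le> S w" for w unfolding S_def by (intro sum_nonneg) auto
    have "continuous_on K S" unfolding S_def
      using p by (intro continuous_on_sum continuous_on_abs_dist_diff_powr)
    then obtain w where w: "w \<in> K" "\<And>v. v \<in> K \<Longrightarrow> S v \<le> S w"
      using continuous_attains_sup[OF K] by blast
    have "(SUP v\<in>K. S v powr (1 / p)) \<le> S w powr (1 / p)"
      using K(2) w S0 p by (intro cSUP_least powr_mono2) auto
    then have "(\<Sum>i=1..n. \<bar>f (x i) - f (y i)\<bar> powr p) powr (1 / p) \<le> C * S w powr (1 / p)"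
      using sums C unfolding eccentric_finite_sums_def S_def
      by (meson mult_left_mono less_imp_le order_trans)
    then have "((\<Sum>i=1..n. \<bar>f (x i) - f (y i)\<bar> powr p) powr (1 / p)) powr p \<le> (C * S w powr (1 / p)) powr p"
      using p by (intro powr_mono2) auto
    then have le: "(\<Sum>i=1..n. \<bar>f (x i) - f (y i)\<bar> powr p) \<le> C powr p * S w"
      using p C S0[of w] by (simp add: powr_mult powr_powr sum_nonneg)
    have "(\<Sum>h\<leftarrow>gs. h w) = (\<Sum>i<n. g (zs ! i) w)"
      unfolding zs n_def by (simp add: sum_list_sum_nth atLeast0LessThan)
    also have "\<dots> = (\<Sum>i=1..n. g (zs ! (i - 1)) w)"
      by (simp add: sum.atLeast1_atMost_eq)
    also have "\<dots> = C powr p * S w - (\<Sum>i=1..n. \<bar>f (x i) - f (y i)\<bar> powr p)"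
      unfolding S_def x_def y_def g_def by (simp add: sum_subtractf sum_distrib_left)
    finally have "0 \<le> (\<Sum>h\<leftarrow>gs. h w)" using le by linarith
    then show ?thesis using w(1) by blast
  qed
  then obtain \<mu> where \<mu>: "regular_borel_prob_on K \<mu>" "\<And>z. 0 \<le> (\<integral>w. g z w \<partial>\<mu>)"
    using exists_measure_nonneg_integrals[OF K(1), of "range g"] gc by blast
  interpret prob_space \<mu> using \<mu> unfolding regular_borel_prob_on_def by blast
  have "\<bar>f x - f y\<bar> powr p \<le> C powr p * (\<integral>w. \<bar>dist x w - dist y w\<bar> powr p \<partial>\<mu>)" for x y
  proof -
    have "integrable \<mu> (\<lambda>w. \<bar>dist x w - dist y w\<bar> powr p)"
      using integrable_continuous_regular_borel_prob_on[OF K(1) \<mu>(1)] continuous_on_abs_dist_diff_powr[OF p]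
      by blast
    then have "(\<integral>w. g (x, y) w \<partial>\<mu>)
        = C powr p * (\<integral>w. \<bar>dist x w - dist y w\<bar> powr p \<partial>\<mu>) - \<bar>f x - f y\<bar> powr p"
      unfolding g_def by (simp add: prob_space)
    then show ?thesis using \<mu>(2)[of "(x, y)"] by linarith
  qed
  then show ?thesis using \<mu>(1) eccentric_dominated_iff_powr[OF p C] by blast
qed

text \<open>Summation commutes with the integral, and the mean of \<open>S\<close> under a
  probability measure on \<open>K\<close> is at most its maximum over \<open>K\<close>.\<close>

lemma eccentric_dominated_imp_finite_sums:
  fixes K :: "'a::metric_space set"
  assumes K: "compact K" "K \<noteq> {}" and p: "1 \<le> p" and C: "C > 0"
    and dom: "eccentric_dominated p C K f"
  shows "eccentric_finite_sums p C K f"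
  unfolding eccentric_finite_sums_def
proof (intro allI)
  fix n :: nat and x y :: "nat \<Rightarrow> 'a"
  obtain \<mu> where \<mu>: "regular_borel_prob_on K \<mu>" and
    le: "\<And>x y. \<bar>f x - f y\<bar> powr p \<le> C powr p * (\<integral>w. \<bar>dist x w - dist y w\<bar> powr p \<partial>\<mu>)"
    using dom eccentric_dominated_iff_powr[OF p C] by blast
  interpret prob_space \<mu> using \<mu> unfolding regular_borel_prob_on_def by blast
  have sp: "space \<mu> = K" using \<mu> unfolding regular_borel_prob_on_def by blast
  define S where "S w = (\<Sum>i=1..n. \<bar>dist (x i) w - dist (y i) w\<bar> powr p)" for w
  have S0: "0 \<le> S w" for w unfolding S_def by (intro sum_nonneg) auto
  have Sc: "continuous_on K S" unfolding S_def
    using p by (intro continuous_on_sum continuous_on_abs_dist_diff_powr)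
  then obtain w where w: "w \<in> K" "\<And>v. v \<in> K \<Longrightarrow> S v \<le> S w"
    using continuous_attains_sup[OF K] by blast
  have int: "integrable \<mu> (\<lambda>w. \<bar>dist a w - dist b w\<bar> powr p)" for a b
    using integrable_continuous_regular_borel_prob_on[OF K(1) \<mu>] continuous_on_abs_dist_diff_powr[OF p]
    by blast
  have "(\<Sum>i=1..n. \<bar>f (x i) - f (y i)\<bar> powr p)
      \<le> (\<Sum>i=1..n. C powr p * (\<integral>w. \<bar>dist (x i) w - dist (y i) w\<bar> powr p \<partial>\<mu>))"
    by (intro sum_mono le)
  also have "\<dots> = C powr p * (\<integral>v. S v \<partial>\<mu>)"
    unfolding S_def using int by (simp add: sum_distrib_left)
  also have "(\<integral>v. S v \<partial>\<mu>) \<le> (\<integral>v. S w \<partial>\<mu>)"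
    using integrable_continuous_regular_borel_prob_on[OF K(1) \<mu> Sc] w(2)
    by (intro integral_mono) (auto simp: sp)
  also have "\<dots> = S w" by (simp add: prob_space)
  finally have "(\<Sum>i=1..n. \<bar>f (x i) - f (y i)\<bar> powr p) \<le> C powr p * S w"
    by (simp add: mult_left_mono)
  then have "(\<Sum>i=1..n. \<bar>f (x i) - f (y i)\<bar> powr p) powr (1 / p) \<le> (C powr p * S w) powr (1 / p)"
    using p by (intro powr_mono2) (auto intro: sum_nonneg)
  also have "\<dots> = C * S w powr (1 / p)" using p C S0[of w] by (simp add: powr_mult powr_powr)
  also have "S w powr (1 / p) \<le> (SUP v\<in>K. S v powr (1 / p))"
    using w S0 p by (intro cSUP_upper) (auto intro!: bdd_aboveI2[of _ _ "S w powr (1 / p)"] powr_mono2)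
  finally show "(\<Sum>i=1..n. \<bar>f (x i) - f (y i)\<bar> powr p) powr (1 / p)
      \<le> C * (SUP w\<in>K. (\<Sum>i=1..n. \<bar>dist (x i) w - dist (y i) w\<bar> powr p) powr (1 / p))"
    using C unfolding S_def by (simp add: mult_left_mono)
qed

text \<open>By the triangle inequality the integrand is at most the constant
  \<open>dist x y powr p\<close>, and \<open>\<mu>\<close> has total mass one. Condition (i) yields
  the same bound through the equivalence.\<close>

lemma eccentric_dominated_imp_lipschitz:
  fixes K :: "'a::metric_space set"
  assumes K: "compact K" and p: "1 \<le> p" and C: "C > 0"
    and dom: "eccentric_dominated p C K f"
  shows "C-lipschitz_on UNIV f"
proof (rule lipschitz_onI)
  fix x y
  obtain \<mu> where \<mu>: "regular_borel_prob_on K \<mu>" and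
    le: "\<And>x y. \<bar>f x - f y\<bar> \<le> C * (\<integral>w. \<bar>dist x w - dist y w\<bar> powr p \<partial>\<mu>) powr (1 / p)"
    using dom unfolding eccentric_dominated_def by blast
  interpret prob_space \<mu> using \<mu> unfolding regular_borel_prob_on_def by blast
  have "(\<integral>w. \<bar>dist x w - dist y w\<bar> powr p \<partial>\<mu>) \<le> (\<integral>w. dist x y powr p \<partial>\<mu>)"
  proof (rule integral_mono)
    show "integrable \<mu> (\<lambda>w. \<bar>dist x w - dist y w\<bar> powr p)"
      using integrable_continuous_regular_borel_prob_on[OF K \<mu>] continuous_on_abs_dist_diff_powr[OF p]
      by blast
    show "\<bar>dist x w - dist y w\<bar> powr p \<le> dist x y powr p" for w
      using p abs_dist_diff_le[of x w y] by (intro powr_mono2) (auto simp: dist_commute)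
  qed simp
  then have "(\<integral>w. \<bar>dist x w - dist y w\<bar> powr p \<partial>\<mu>) powr (1 / p) \<le> (dist x y powr p) powr (1 / p)"
    using p by (intro powr_mono2) (auto simp: prob_space)
  also have "\<dots> = dist x y" using p by (simp add: powr_powr)
  finally show "dist (f x) (f y) \<le> C * dist x y"
    using le[of x y] C by (smt (verit) dist_real_def mult_left_mono)
qed (use C in auto)

theorem theorem3p2:
  fixes K :: "'a::metric_space set" and f :: "'a \<Rightarrow> real" and p C :: real
  assumes "compact K" and "K \<noteq> {}" and "1 \<le> p" and "C > 0"
  shows "(eccentric_finite_sums p C K f \<longleftrightarrow> eccentric_dominated p C K f) \<and>
         (eccentric_finite_sums p C K f \<or> eccentric_dominated p C K f
            \<longrightarrow> C-lipschitz_on UNIV f)"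
  using assms eccentric_finite_sums_imp_dominated eccentric_dominated_imp_finite_sums
    eccentric_dominated_imp_lipschitz by metis

end
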